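(* Let $d,N\in\mathbb{N}$, $0<\alpha<1$, $0<\beta<1$, and let $\{S_i\}_{i=1}^N$ be a family of $(\alpha,\beta(\alpha\beta)^{N-1})$-winning sets of $\mathbb{R}^d$. Then $\bigcap_{i=1}^N S_i$ is an $(\alpha,\beta)$-winning set of $\mathbb{R}^d$.
   Context: Fix a norm on $\mathbb{R}^d$; closed balls are taken in this norm. Schmidt game: for a closed ball $B$ (positive radius, radius denoted $\rho(B)$) and $0<\gamma\le 1$, let $B^\gamma$ be the collection of closed balls $\widetilde B\subset B$ with $\rho(\widetilde B)=\gamma\rho(B)$. For $S\subset\mathbb{R}^d$ and $0<\alpha,\beta<1$, in the $(\alpha,\beta;S)$-game Bob chooses an arbitrary closed ball $B_1$, and then, for $n\ge1$, Alice chooses $A_n\in B_n^\alpha$ and Bob chooses $B_{n+1}\in A_n^\beta$. The intersection $\bigcap_{n} B_n$ is a single point. $S$ is an $(\alpha,\beta)$-winning set of $\mathbb{R}^d$ if Alice has a strategy ensuring, whatever Bob plays (including $B_1$), that this point lies in $S$. *)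

theory Defs
  imports "HOL-Analysis.Analysis"
begin

definition is_norm :: "(real ^ 'd \<Rightarrow> real) \<Rightarrow> bool" where
  "is_norm nrm \<longleftrightarrow>
     (\<forall>x. 0 \<le> nrm x) \<and>
     (\<forall>x. nrm x = 0 \<longleftrightarrow> x = 0) \<and>
     (\<forall>c x. nrm (c *\<^sub>R x) = \<bar>c\<bar> * nrm x) \<and>
     (\<forall>x y. nrm (x + y) \<le> nrm x + nrm y)"

definition closed_ball :: "(real ^ 'd \<Rightarrow> real) \<Rightarrow> real ^ 'd \<Rightarrow> real \<Rightarrow> (real ^ 'd) set" where
  "closed_ball nrm c r = {x. nrm (x - c) \<le> r}"

definition is_closed_ball :: "(real ^ 'd \<Rightarrow> real) \<Rightarrow> (real ^ 'd) set \<Rightarrow> bool" where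
  "is_closed_ball nrm B \<longleftrightarrow> (\<exists>c r. 0 < r \<and> B = closed_ball nrm c r)"

text \<open>As the dimension is positive, a closed ball (as a set) determines its radius.\<close>

definition ball_radius :: "(real ^ 'd \<Rightarrow> real) \<Rightarrow> (real ^ 'd) set \<Rightarrow> real" where
  "ball_radius nrm B = (THE r. 0 < r \<and> (\<exists>c. B = closed_ball nrm c r))"

text \<open>The collection \<open>B\<^sup>\<gamma>\<close> of legal moves inside the ball \<open>B\<close>.\<close>

definition subballs :: "(real ^ 'd \<Rightarrow> real) \<Rightarrow> real \<Rightarrow> (real ^ 'd) set \<Rightarrow> (real ^ 'd) set set" where
  "subballs nrm \<gamma> B =
     {B'. is_closed_ball nrm B' \<and> B' \<subseteq> B \<and> ball_radius nrm B' = \<gamma> * ball_radius nrm B}"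

text \<open>
  A strategy for Alice maps the list of all balls played so far by Bob to her reply (her own
  earlier moves are determined by the strategy). Rounds are counted from \<open>0\<close>, so \<open>B 0\<close> is the
  ball called \<open>B\<^sub>1\<close> in the usual description of the game.
\<close>

type_synonym 'd strategy = "(real ^ 'd) set list \<Rightarrow> (real ^ 'd) set"

definition alice_move :: "'d strategy \<Rightarrow> (nat \<Rightarrow> (real ^ 'd) set) \<Rightarrow> nat \<Rightarrow> (real ^ 'd) set" where
  "alice_move \<sigma> B n = \<sigma> (map B [0..<Suc n])"

text \<open>Bob's moves \<open>B 0, \<dots>, B n\<close> obey the rules when Alice replies according to \<open>\<sigma>\<close>.\<close>

definition bob_legal_upto ::
  "(real ^ 'd \<Rightarrow> real) \<Rightarrow> real \<Rightarrow> 'd strategy \<Rightarrow> (nat \<Rightarrow> (real ^ 'd) set) \<Rightarrow> nat \<Rightarrow> bool" where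
  "bob_legal_upto nrm \<beta> \<sigma> B n \<longleftrightarrow>
     is_closed_ball nrm (B 0) \<and> (\<forall>k<n. B (Suc k) \<in> subballs nrm \<beta> (alice_move \<sigma> B k))"

text \<open>
  Legality of Alice's replies is demanded after every finite legal play, not only along infinite
  plays: otherwise Alice could win vacuously by an illegal move to which Bob has no legal answer.
\<close>

definition winning_set ::
  "(real ^ 'd \<Rightarrow> real) \<Rightarrow> real \<Rightarrow> real \<Rightarrow> (real ^ 'd) set \<Rightarrow> bool" where
  "winning_set nrm \<alpha> \<beta> S \<longleftrightarrow>
     (\<exists>\<sigma>. (\<forall>B n. bob_legal_upto nrm \<beta> \<sigma> B n \<longrightarrow> alice_move \<sigma> B n \<in> subballs nrm \<alpha> (B n)) \<and>
          (\<forall>B. (\<forall>n. bob_legal_upto nrm \<beta> \<sigma> B n) \<longrightarrow> (\<exists>x\<in>S. (\<Inter>n. B n) = {x})))"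

end

theory Submission imports Defs begin

text \<open>
  Alice splits the game into \<open>N\<close> interleaved games: in the rounds congruent to \<open>j\<close> modulo \<open>N\<close> she
  follows a winning strategy for the \<open>j\<close>-th set and ignores all other rounds. Between two
  consecutive such rounds the radius of Bob's ball shrinks, relative to Alice's last move, by exactly
  \<open>\<beta> * (\<alpha> * \<beta>) ^ (N - 1)\<close>, so every interleaved game is a legal play with that parameter. By
  nestedness all the interleaved games converge to the same point.
\<close>

text \<open>\<open>alice_move\<close> passes Bob's balls of rounds 0 to \<open>k\<close>, so the
  current round is the length minus one. Balls from other residue classes are hidden from the
  strategy consulted.\<close>

definition interleave :: "nat \<Rightarrow> (nat \<Rightarrow> 'd strategy) \<Rightarrow> 'd strategy" where
  "interleave N \<tau> L = (let k = length L - 1 in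
     \<tau> (k mod N) (map (\<lambda>m. L ! (k mod N + N * m)) [0..<Suc (k div N)]))"

lemma alice_move_interleave:
  assumes "j < N"
  shows "alice_move (interleave N \<tau>) B (j + N * m) = alice_move (\<tau> j) (\<lambda>m. B (j + N * m)) m"
proof -
  have eq: "map (\<lambda>i. map B [0..<Suc (j + N * m)] ! (j + N * i)) [0..<Suc m]
      = map (\<lambda>i. B (j + N * i)) [0..<Suc m]"
  proof (rule map_cong[OF refl])
    fix i assume "i \<in> set [0..<Suc m]"
    then have "j + N * i < Suc (j + N * m)" by (auto simp: less_Suc_eq_le)
    then show "map B [0..<Suc (j + N * m)] ! (j + N * i) = B (j + N * i)"
      by (simp add: nth_map_upt del: upt_Suc)
  qed
  have "interleave N \<tau> (map B [0..<Suc (j + N * m)])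
      = \<tau> j (map (\<lambda>i. map B [0..<Suc (j + N * m)] ! (j + N * i)) [0..<Suc m])"
    using assms by (simp add: interleave_def Let_def del: upt_Suc)
  then show ?thesis
    unfolding alice_move_def eq .
qed

lemma bob_legal_upto_mono:
  "bob_legal_upto nrm \<beta> \<sigma> B n \<Longrightarrow> m \<le> n \<Longrightarrow> bob_legal_upto nrm \<beta> \<sigma> B m"
  by (auto simp: bob_legal_upto_def)

lemma bob_legal_upto_closed_ball:
  assumes "bob_legal_upto nrm \<beta> \<sigma> B n"
  shows "is_closed_ball nrm (B n)"
  using assms by (cases n) (auto simp: bob_legal_upto_def subballs_def)

lemma subballs_trans:
  assumes "B' \<in> subballs nrm \<gamma> B" "B'' \<in> subballs nrm \<delta> B'"
  shows "B'' \<in> subballs nrm (\<delta> * \<gamma>) B"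
  using assms by (auto simp: subballs_def)

text \<open>Between the two balls lie \<open>t + 1\<close> moves of Bob and \<open>t\<close> of
  Alice, and their ratios multiply.\<close>

lemma bob_move_in_earlier_alice_move:
  assumes "bob_legal_upto nrm \<beta> \<sigma> B (k + Suc t)"
    and "\<And>i. i < k + Suc t \<Longrightarrow> alice_move \<sigma> B i \<in> subballs nrm \<alpha> (B i)"
  shows "B (k + Suc t) \<in> subballs nrm (\<beta> * (\<alpha> * \<beta>) ^ t) (alice_move \<sigma> B k)"
  using assms
proof (induction t)
  case 0
  then show ?case by (simp add: bob_legal_upto_def)
next
  case (Suc t)
  have "B (k + Suc t) \<in> subballs nrm (\<beta> * (\<alpha> * \<beta>) ^ t) (alice_move \<sigma> B k)"
    using Suc.prems by (intro Suc.IH bob_legal_upto_mono[OF Suc.prems(1)]) auto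
  moreover have "alice_move \<sigma> B (k + Suc t) \<in> subballs nrm \<alpha> (B (k + Suc t))"
    using Suc.prems(2) by simp
  moreover have "B (k + Suc (Suc t)) \<in> subballs nrm \<beta> (alice_move \<sigma> B (k + Suc t))"
    using Suc.prems(1) by (simp add: bob_legal_upto_def)
  ultimately have "B (k + Suc (Suc t)) \<in>
      subballs nrm (\<beta> * (\<alpha> * (\<beta> * (\<alpha> * \<beta>) ^ t))) (alice_move \<sigma> B k)"
    by (blast intro: subballs_trans)
  then show ?case by (simp add: mult_ac)
qed

text \<open>Only replies strictly before round \<open>j + N * m\<close> are assumed legal, so that
  the lemma can serve in an induction establishing the legality of that very reply.\<close>

lemma bob_legal_upto_interleaved:
  assumes "j < N"
    and legal: "bob_legal_upto nrm \<beta> (interleave N \<tau>) B (j + N * m)"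
    and alice: "\<And>i. i < j + N * m \<Longrightarrow>
      alice_move (interleave N \<tau>) B i \<in> subballs nrm \<alpha> (B i)"
  shows "bob_legal_upto nrm (\<beta> * (\<alpha> * \<beta>) ^ (N - 1)) (\<tau> j) (\<lambda>m. B (j + N * m)) m"
  unfolding bob_legal_upto_def
proof (intro conjI allI impI)
  \<comment> \<open>The interleaved game opens with \<open>B j\<close>; an opening move may be any
    closed ball, so how it arose does not matter.\<close>
  show "is_closed_ball nrm (B (j + N * 0))"
    using legal by (intro bob_legal_upto_closed_ball[OF bob_legal_upto_mono[OF legal]]) simp
next
  fix k assume "k < m"
  \<comment> \<open>Consecutive rounds of one residue class are \<open>N\<close> apart, which gives
    the exponent \<open>t = N - 1\<close>.\<close>
  have eq: "j + N * Suc k = (j + N * k) + Suc (N - 1)"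
    using \<open>j < N\<close> by simp
  have le: "(j + N * k) + Suc (N - 1) \<le> j + N * m"
    using \<open>k < m\<close> unfolding eq[symmetric] by (intro add_left_mono mult_le_mono2) simp
  have "B (j + N * Suc k) \<in> subballs nrm (\<beta> * (\<alpha> * \<beta>) ^ (N - 1))
      (alice_move (interleave N \<tau>) B (j + N * k))"
    unfolding eq
    by (rule bob_move_in_earlier_alice_move[OF bob_legal_upto_mono[OF legal le] alice])
       (rule less_le_trans[OF _ le])
  then show "B (j + N * Suc k) \<in> subballs nrm (\<beta> * (\<alpha> * \<beta>) ^ (N - 1))
      (alice_move (\<tau> j) (\<lambda>m. B (j + N * m)) k)"
    by (simp only: alice_move_interleave[OF \<open>j < N\<close>])
qed

text \<open>Strong induction is needed: Bob's legality in one interleaved game rests on Alice's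
  earlier replies in all residue classes.\<close>

lemma alice_legal_interleave:
  assumes "0 < N"
    and "\<And>j B n. j < N \<Longrightarrow> bob_legal_upto nrm (\<beta> * (\<alpha> * \<beta>) ^ (N - 1)) (\<tau> j) B n \<Longrightarrow>
      alice_move (\<tau> j) B n \<in> subballs nrm \<alpha> (B n)"
    and "bob_legal_upto nrm \<beta> (interleave N \<tau>) B n"
  shows "alice_move (interleave N \<tau>) B n \<in> subballs nrm \<alpha> (B n)"
  using assms(3)
proof (induction n rule: less_induct)
  case (less n)
  define j m where "j = n mod N" and "m = n div N"
  have "j < N" and n: "n = j + N * m"
    using \<open>0 < N\<close> by (auto simp: j_def m_def)
  have "bob_legal_upto nrm (\<beta> * (\<alpha> * \<beta>) ^ (N - 1)) (\<tau> j) (\<lambda>m. B (j + N * m)) m"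
    using less.prems less.IH bob_legal_upto_mono[OF less.prems]
    by (intro bob_legal_upto_interleaved[OF \<open>j < N\<close>]) (auto simp: n)
  from assms(2)[OF \<open>j < N\<close> this] show ?case
    by (simp add: n alice_move_interleave[OF \<open>j < N\<close>])
qed

text \<open>The indices \<open>j + N * m\<close> are cofinal, and the sets decrease.\<close>

lemma INT_decseq_subsequence:
  fixes B :: "nat \<Rightarrow> 'a set"
  assumes "decseq B" "0 < N"
  shows "(\<Inter>m. B (j + N * m)) = (\<Inter>n. B n)"
proof
  show "(\<Inter>m. B (j + N * m)) \<subseteq> (\<Inter>n. B n)"
  proof
    fix x assume x: "x \<in> (\<Inter>m. B (j + N * m))"
    have "x \<in> B n" for n
    proof -
      have "n \<le> j + N * n" using \<open>0 < N\<close> by (simp add: trans_le_add2)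
      then show ?thesis using x decseqD[OF \<open>decseq B\<close>] by blast
    qed
    then show "x \<in> (\<Inter>n. B n)" by simp
  qed
qed blast

theorem theorem7p2:
  fixes nrm :: "real ^ 'd \<Rightarrow> real"
    and N :: nat
    and \<alpha> \<beta> :: real
    and S :: "nat \<Rightarrow> (real ^ 'd) set"
  assumes "is_norm nrm"
    and "1 \<le> N"
    and "0 < \<alpha>" and "\<alpha> < 1"
    and "0 < \<beta>" and "\<beta> < 1"
    and "\<And>i. i \<in> {1..N} \<Longrightarrow> winning_set nrm \<alpha> (\<beta> * (\<alpha> * \<beta>) ^ (N - 1)) (S i)"
  shows "winning_set nrm \<alpha> \<beta> (\<Inter>i\<in>{1..N}. S i)"
proof -
  let ?\<gamma> = "\<beta> * (\<alpha> * \<beta>) ^ (N - 1)"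
  have "0 < N" using assms(2) by simp
  \<comment> \<open>Residues run from 0 to \<open>N - 1\<close> but the sets from 1 to
    \<open>N\<close>, hence \<open>S (Suc j)\<close>. The guard under the existential lets choice
    yield a total \<open>\<tau>\<close>.\<close>
  have "\<forall>j. \<exists>\<sigma>. j < N \<longrightarrow>
      (\<forall>B n. bob_legal_upto nrm ?\<gamma> \<sigma> B n \<longrightarrow> alice_move \<sigma> B n \<in> subballs nrm \<alpha> (B n)) \<and>
      (\<forall>B. (\<forall>n. bob_legal_upto nrm ?\<gamma> \<sigma> B n) \<longrightarrow> (\<exists>x\<in>S (Suc j). (\<Inter>n. B n) = {x}))"
    using assms(7) unfolding winning_set_def by simp
  then obtain \<tau> where
    \<tau>_legal: "\<And>j B n. j < N \<Longrightarrow> bob_legal_upto nrm ?\<gamma> (\<tau> j) B n \<Longrightarrow>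
      alice_move (\<tau> j) B n \<in> subballs nrm \<alpha> (B n)" and
    \<tau>_wins: "\<And>j B. j < N \<Longrightarrow> (\<And>n. bob_legal_upto nrm ?\<gamma> (\<tau> j) B n) \<Longrightarrow>
      \<exists>x\<in>S (Suc j). (\<Inter>n. B n) = {x}"
    by metis
  let ?\<sigma> = "interleave N \<tau>"
  have legal: "alice_move ?\<sigma> B n \<in> subballs nrm \<alpha> (B n)"
    if "bob_legal_upto nrm \<beta> ?\<sigma> B n" for B n
    using alice_legal_interleave[OF \<open>0 < N\<close> \<tau>_legal that] .
  have wins: "\<exists>x\<in>(\<Inter>i\<in>{1..N}. S i). (\<Inter>n. B n) = {x}"
    if bob: "\<And>n. bob_legal_upto nrm \<beta> ?\<sigma> B n" for B
  proof -
    \<comment> \<open>Alice's reply in round \<open>n\<close> lies between the two balls.\<close>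
    have "B (Suc n) \<subseteq> B n" for n
      using bob[of "Suc n"] legal[OF bob, of n]
      by (auto simp: bob_legal_upto_def subballs_def)
    then have dec: "decseq B" by (simp add: decseq_Suc_iff)
    have point: "\<exists>x\<in>S (Suc j). (\<Inter>n. B n) = {x}" if "j < N" for j
    proof -
      have "bob_legal_upto nrm ?\<gamma> (\<tau> j) (\<lambda>m. B (j + N * m)) m" for m
        using bob legal[OF bob] by (intro bob_legal_upto_interleaved[OF that])
      from \<tau>_wins[OF that this] show ?thesis
        by (simp add: INT_decseq_subsequence[OF dec \<open>0 < N\<close>])
    qed
    \<comment> \<open>The intersection does not depend on \<open>j\<close>, so the point found from
      game 0 is the one that every game places in its own set.\<close>
    obtain x where x: "(\<Inter>n. B n) = {x}" using point[OF \<open>0 < N\<close>] by blast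
    have "x \<in> S i" if "i \<in> {1..N}" for i
      using point[of "i - 1"] x that by auto
    with x show ?thesis by blast
  qed
  show ?thesis
    unfolding winning_set_def using legal wins by blast
qed

end
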